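(* Let $n\ge 3$ and let $\mathbb T$ be a full Steiner tree in the plane with terminals $P_1,\dots,P_n$, $P_j=(x_j,y_j)$, and put $z_j:=x_j+\mathbf i y_j\in\mathbb C$. For each $j$ let $\overrightarrow{\ell_j}$ be the direction of the terminal $P_j$ in $\mathbb T$. Assign to each terminal $P_j$ a sixth root of unity $U_j$ as follows: $U_1:=\upsilon_0=1$, and for each $j$, $U_j:=\upsilon_k$ if the angle between $\overrightarrow{\ell_1}$ and $\overrightarrow{\ell_j}$ counted clockwise equals $k\pi/3$ ($k\in\{0,1,\dots,5\}$). Then the length of $\mathbb T$ equals $$\mathfrak L(\mathbb T)=\left|\sum_{j=1}^n z_jU_j\right|.$$
   Context: A Steiner tree for a set of terminals in $\mathbb R^2$ is a tree whose vertices are the terminals together with extra vertices (Steiner points), each Steiner point having degree $3$ with its three incident edges meeting pairwise at angles $2\pi/3$. A full Steiner tree with $n$ terminals is such a tree containing exactly $n-2$ Steiner points; then every terminal has degree $1$. Its length $\mathfrak L(\mathbb T)$ is the sum of the Euclidean lengths of its edges. If the terminal $P_j$ is joined by an edge to the Steiner point $S$, the direction of $P_j$ in $\mathbb T$ is the unit vector $\overrightarrow{\ell_j}:=\overrightarrow{SP_j}/|SP_j|$; in a full Steiner tree the angle between any two such directions is an integer multiple of $\pi/3$. The sixth roots of unity are $\upsilon_k:=\cos\frac{\pi k}{3}+\mathbf i\sin\frac{\pi k}{3}$, $k\in\{0,1,\dots,5\}$. *)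

theory Defs
  imports "HOL-Analysis.Analysis" "Graph_Theory.Graph_Theory"
begin

text \<open>
  Geometric graphs are finite simple graphs in the sense of \<open>pair_graph\<close>: vertices are points of
  the plane, and every edge is represented by both of its orientations. For such symmetric
  digraphs the library predicate \<open>tree\<close> is unusable, since going back and forth along one edge
  counts as a \<open>cycle\<close> there; the cycles of an undirected simple graph are those of length at
  least three.
\<close>

type_synonym plane_graph = "(real \<times> real) pair_pre_digraph"

definition undirected_tree :: "'a pair_pre_digraph \<Rightarrow> bool" where
  "undirected_tree T \<longleftrightarrow> pair_graph T \<and> Digraph_Component.connected (with_proj T) \<and>
     \<not> (\<exists>p. pre_digraph.cycle (with_proj T) p \<and> 3 \<le> length p)"

definition vector_angle :: "'a::real_inner \<Rightarrow> 'a \<Rightarrow> real" where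
  "vector_angle u v = arccos ((u \<bullet> v) / (norm u * norm v))"

definition steiner_points :: "(real \<times> real) set \<Rightarrow> plane_graph \<Rightarrow> (real \<times> real) set" where
  "steiner_points X T = pverts T - X"

definition steiner_tree :: "(real \<times> real) set \<Rightarrow> plane_graph \<Rightarrow> bool" where
  "steiner_tree X T \<longleftrightarrow> undirected_tree T \<and> X \<subseteq> pverts T \<and>
     (\<forall>S \<in> steiner_points X T.
        out_degree (with_proj T) S = 3 \<and>
        (\<forall>A B. (S, A) \<in> parcs T \<and> (S, B) \<in> parcs T \<and> A \<noteq> B \<longrightarrow>
           vector_angle (A - S) (B - S) = 2 * pi / 3))"

definition full_steiner_tree :: "(real \<times> real) set \<Rightarrow> plane_graph \<Rightarrow> bool" where
  "full_steiner_tree X T \<longleftrightarrow> steiner_tree X T \<and>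
     int (card (steiner_points X T)) = int (card X) - 2"

text \<open>Every edge contributes two arcs, hence the division by two.\<close>

definition tree_length :: "plane_graph \<Rightarrow> real" where
  "tree_length T = (\<Sum>(A, B) \<in> parcs T. dist A B) / 2"

text \<open>Only meaningful for a terminal adjacent to exactly one Steiner point, as is every terminal
  of a full Steiner tree with at least three terminals.\<close>

definition terminal_direction :: "(real \<times> real) set \<Rightarrow> plane_graph \<Rightarrow> real \<times> real \<Rightarrow> real \<times> real" where
  "terminal_direction X T p =
     (let S = (THE S. S \<in> steiner_points X T \<and> (p, S) \<in> parcs T)
      in (p - S) /\<^sub>R norm (p - S))"

definition complex_of_point :: "real \<times> real \<Rightarrow> complex" where
  "complex_of_point p = Complex (fst p) (snd p)"

text \<open>The angle in \<open>[0, 2\<pi>)\<close> by which \<open>u\<close> has to be turned clockwise to point in the direction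
  of \<open>v\<close>: if \<open>v = u * cis (- \<theta>)\<close> then \<open>u / v = cis \<theta>\<close>.\<close>

definition clockwise_angle :: "real \<times> real \<Rightarrow> real \<times> real \<Rightarrow> real" where
  "clockwise_angle u v = Arg2pi (complex_of_point u / complex_of_point v)"

definition sixth_root :: "nat \<Rightarrow> complex" where
  "sixth_root k = complex_of_real (cos (pi * real k / 3)) + \<i> * complex_of_real (sin (pi * real k / 3))"

end

theory Submission
  imports Defs
begin

text \<open>Write \<open>d(A, B)\<close> for the unit complex number pointing from \<open>A\<close> to \<open>B\<close>. Summing
  \<open>A * cnj (d(A, B))\<close> over all arcs and pairing each arc with its reverse gives minus the length of
  the tree. Grouped by \<open>A\<close> instead, the Steiner points drop out because their three directions
  cancel, and a terminal, being a leaf next to a Steiner point, contributes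
  \<open>- z\<^sub>j * cnj (l\<^sub>j)\<close>. Hence the length equals \<open>\<Sum>\<^sub>j z\<^sub>j * cnj (l\<^sub>j)\<close>. Since the ratios of the
  \<open>l\<^sub>j\<close> are sixth roots of unity, \<open>U\<^sub>j = l\<^sub>1 * cnj (l\<^sub>j)\<close>, so the sum in the theorem is the
  length times the unit \<open>l\<^sub>1\<close>. That terminals are leaves follows by comparing the sum of the degrees
  with the bound \<open>2 * (card V - 1)\<close> on the number of arcs.\<close>

section \<open>Counting arcs of acyclic graphs\<close>

text \<open>A cycle is a list of distinct vertices closed up by an arc; length at least three keeps
  the two orientations of one edge from counting. A bare relation makes it easy to delete vertices
  in an induction.\<close>

definition cycle_free :: "'a rel \<Rightarrow> bool" where
  "cycle_free E \<longleftrightarrow> \<not> (\<exists>vs. 3 \<le> length vs \<and> distinct vs \<and>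
     successively (\<lambda>a b. (a, b) \<in> E) vs \<and> (last vs, hd vs) \<in> E)"

lemma cycle_free_subset: "cycle_free E \<Longrightarrow> F \<subseteq> E \<Longrightarrow> cycle_free F"
  unfolding cycle_free_def by (meson subsetD successively_mono)

text \<open>Take the first vertex \<open>v\<close> of a longest simple path. By maximality all its
  neighbours lie on the path, and one beyond the second vertex would close a cycle.\<close>

lemma cycle_free_leaf:
  assumes "finite V" "V \<noteq> {}" "E \<subseteq> V \<times> V" "sym E" "irrefl E" "cycle_free E"
  shows "\<exists>v\<in>V. card (E `` {v}) \<le> 1"
proof -
  define path where
    "path vs \<longleftrightarrow> vs \<noteq> [] \<and> distinct vs \<and> set vs \<subseteq> V \<and> successively (\<lambda>a b. (a, b) \<in> E) vs" for vs
  obtain v0 where "v0 \<in> V" using assms(2) by blast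
  then have "path [v0]" by (simp add: path_def)
  moreover have "length vs < Suc (card V)" if "path vs" for vs
    using that \<open>finite V\<close> unfolding path_def
    by (metis card_mono distinct_card less_Suc_eq_le)
  ultimately obtain vs where vs: "path vs" and longest: "\<And>ws. path ws \<Longrightarrow> length ws \<le> length vs"
    using ex_has_greatest_nat[of path _ length] by (metis less_imp_le_nat)
  obtain v ws where vws: "vs = v # ws" using vs by (cases vs) (auto simp: path_def)
  have nb: "x \<in> set ws" if "(v, x) \<in> E" for x
  proof (rule ccontr)
    assume "x \<notin> set ws"
    moreover have "x \<noteq> v" using that \<open>irrefl E\<close> by (auto simp: irrefl_def)
    moreover have "(x, v) \<in> E" "x \<in> V" using that assms(3,4) by (auto dest: symD)
    ultimately have "path (x # vs)" using vs vws by (auto simp: path_def)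
    then show False using longest by fastforce
  qed
  \<comment> \<open>If \<open>ws\<close> is empty, \<open>hd ws\<close> is unspecified, but then
    \<open>nb\<close> leaves \<open>v\<close> without neighbours.\<close>
  have "E `` {v} \<subseteq> {hd ws}"
  proof
    fix x assume "x \<in> E `` {v}"
    then have vx: "(v, x) \<in> E" by simp
    then obtain as bs where ws: "ws = as @ x # bs" using nb by (meson split_list)
    \<comment> \<open>\<open>as\<close> lists the vertices strictly between \<open>v\<close> and
      \<open>x\<close>; if there are any, the path from \<open>v\<close> to \<open>x\<close> and the
      arc back form a cycle.\<close>
    have "as = []"
    proof (rule ccontr)
      assume "as \<noteq> []"
      have "successively (\<lambda>a b. (a, b) \<in> E) ((v # as @ [x]) @ bs)"
        using vs vws ws by (simp add: path_def)
      then have "successively (\<lambda>a b. (a, b) \<in> E) (v # as @ [x])"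
        unfolding successively_append_iff by blast
      moreover have "3 \<le> length (v # as @ [x])" using \<open>as \<noteq> []\<close> by (cases as) auto
      moreover have "distinct (v # as @ [x])" using vs vws ws by (auto simp: path_def)
      moreover have "(last (v # as @ [x]), hd (v # as @ [x])) \<in> E"
        using vx \<open>sym E\<close> by (auto dest: symD)
      ultimately show False using \<open>cycle_free E\<close> unfolding cycle_free_def by blast
    qed
    then show "x \<in> {hd ws}" using ws by simp
  qed
  then have "card (E `` {v}) \<le> 1" using card_mono[of "{hd ws}"] by simp
  moreover have "v \<in> V" using vs vws by (simp add: path_def)
  ultimately show ?thesis by blast
qed

text \<open>Induction on the number of vertices: deleting a vertex with at most one neighbour
  removes at most the two orientations of one edge.\<close>

lemma cycle_free_card_arcs:
  assumes "finite V" "V \<noteq> {}" "E \<subseteq> V \<times> V" "sym E" "irrefl E" "cycle_free E"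
  shows "card E \<le> 2 * (card V - 1)"
  using assms
proof (induction "card V" arbitrary: V E rule: less_induct)
  case less
  obtain v where v: "v \<in> V" "card (E `` {v}) \<le> 1"
    using cycle_free_leaf[OF less.prems] by blast
  define W where "W = V - {v}"
  define F where "F = E \<inter> W \<times> W"
  have finE: "finite E" using less.prems(1,3) finite_subset by blast
  show ?case
  \<comment> \<open>The single-vertex case is separate because the induction hypothesis needs a
    nonempty vertex set.\<close>
  proof (cases "W = {}")
    case True
    then have "V = {v}" using v(1) by (auto simp: W_def)
    then have "E = {}" using less.prems(3,5) by (fastforce simp: irrefl_def)
    then show ?thesis by simp
  next
    case False
    have cW: "card V = Suc (card W)" "card W > 0"
      using card_Suc_Diff1[OF less.prems(1) v(1)] less.prems(1) False
      by (simp_all add: W_def card_gt_0_iff)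
    have "cycle_free F" using less.prems(6) by (rule cycle_free_subset) (simp add: F_def)
    moreover have "sym F" "irrefl F" "F \<subseteq> W \<times> W" "finite W"
      using less.prems(1,4,5) by (auto simp: F_def W_def sym_def irrefl_def)
    ultimately have "card F \<le> 2 * (card W - 1)"
      using False cW by (intro less.hyps) simp_all
    moreover have "E \<subseteq> F \<union> ({v} \<times> E `` {v} \<union> (E `` {v}) \<times> {v})"
      using less.prems(3,4) by (auto simp: F_def W_def dest: symD)
    moreover have "finite (E `` {v})" using finE by (rule finite_Image)
    moreover have "finite F" using finE by (simp add: F_def)
    ultimately have "card E \<le> card (F \<union> ({v} \<times> E `` {v} \<union> (E `` {v}) \<times> {v}))"
      by (intro card_mono) auto
    also have "\<dots> \<le> card F + (card ({v} \<times> E `` {v}) + card ((E `` {v}) \<times> {v}))"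
      by (meson add_left_mono card_Un_le order_trans)
    also have "\<dots> \<le> 2 * (card W - 1) + (1 + 1)"
      using v(2) \<open>card F \<le> _\<close> by (simp add: card_cartesian_product)
    finally show ?thesis using cW by simp
  qed
qed

section \<open>Undirected trees\<close>

text \<open>Translates vertex lists into the arc lists of library walks: the zip pairs each vertex
  with its successor, and \<open>w = hd vs\<close> closes the walk.\<close>

lemma closed_walk_of_vertices:
  assumes "vs \<noteq> []"
  shows "pcas (hd vs) (zip vs (tl vs @ [w])) w"
    and "pawalk_verts (hd vs) (zip vs (tl vs @ [w])) = vs @ [w]"
  using assms
proof (induction vs)
  case (Cons v vs)
  { case 1 then show ?case using Cons by (cases vs) auto }
  { case 2 then show ?case using Cons by (cases vs) auto }
qed auto

lemma set_closed_walk: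
  assumes "successively (\<lambda>a b. (a, b) \<in> E) vs" "vs \<noteq> []" "(last vs, w) \<in> E"
  shows "set (zip vs (tl vs @ [w])) \<subseteq> E"
  using assms
proof (induction vs)
  case (Cons v vs)
  then show ?case by (cases vs) auto
qed auto

context
  fixes T :: "'a pair_pre_digraph"
  assumes T: "undirected_tree T"
begin

interpretation pair_graph T using T by (simp add: undirected_tree_def)

lemma undirected_tree_finite: "finite (pverts T)" "finite (parcs T)"
  by (rule pair_finite_verts pair_finite_arcs)+

lemma undirected_tree_arcs_subset: "parcs T \<subseteq> pverts T \<times> pverts T"
  by (auto dest: in_arcsD1 in_arcsD2)

lemma undirected_tree_sym: "sym (parcs T)"
  using pair_sym_arcs by (simp add: symmetric_def)

lemma undirected_tree_irrefl: "irrefl (parcs T)"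
  using pair_no_loops by (fastforce simp: irrefl_def)

lemma undirected_tree_cycle_free: "cycle_free (parcs T)"
  unfolding cycle_free_def
proof clarify
  fix vs assume vs: "3 \<le> length vs" "distinct vs" "successively (\<lambda>a b. (a, b) \<in> parcs T) vs"
    "(last vs, hd vs) \<in> parcs T"
  define p where "p = zip vs (tl vs @ [hd vs])"
  have ne: "vs \<noteq> []" using vs(1) by auto
  have "awalk (hd vs) p (hd vs)"
    using closed_walk_of_vertices(1)[OF ne, of "hd vs"] set_closed_walk[OF vs(3) ne vs(4)] vs(4)
      in_arcsD2
    by (simp add: awalk_def p_def)
  \<comment> \<open>The visited vertices are \<open>vs @ [hd vs]\<close>; without the first one they
    are a rotation of \<open>vs\<close>.\<close>
  moreover have "distinct (tl (pawalk_verts (hd vs) p))"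
    using closed_walk_of_vertices(2)[OF ne, of "hd vs"] vs(2) ne
    by (cases vs) (auto simp: p_def)
  moreover have "length p = length vs" using ne by (cases vs) (auto simp: p_def)
  ultimately have "cycle p \<and> 3 \<le> length p" using vs(1) by (auto simp: cycle_def)
  then show False using T unfolding undirected_tree_def by blast
qed

lemma undirected_tree_connected:
  assumes "a \<in> pverts T" "b \<in> pverts T"
  shows "(a, b) \<in> (parcs T)\<^sup>*"
proof -
  \<comment> \<open>Connectedness refers to the symmetric closure, which adds no arcs to an already
    symmetric graph.\<close>
  have "parcs (mk_symmetric (with_proj T)) = parcs T"
    using undirected_tree_sym by (auto simp: parcs_mk_symmetric dest: symD)
  moreover have "a \<rightarrow>\<^sup>*\<^bsub>with_proj (mk_symmetric (with_proj T))\<^esub> b"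
    using T assms
    by (simp add: undirected_tree_def connected_def strongly_connected_def mk_symmetric_def)
  ultimately show ?thesis by (auto dest: reachable_rtranclI)
qed

lemma undirected_tree_card_arcs: "pverts T \<noteq> {} \<Longrightarrow> card (parcs T) \<le> 2 * (card (pverts T) - 1)"
  by (intro cycle_free_card_arcs undirected_tree_finite undirected_tree_arcs_subset
      undirected_tree_sym undirected_tree_irrefl undirected_tree_cycle_free)

lemma undirected_tree_neighbour:
  assumes "a \<in> pverts T" "b \<in> pverts T" "a \<noteq> b"
  shows "parcs T `` {a} \<noteq> {}"
  using undirected_tree_connected[OF assms(1,2)] assms(3) by (auto elim: converse_rtranclE)

lemma undirected_tree_out_degree: "out_degree (with_proj T) v = card (parcs T `` {v})"
proof -
  have "out_arcs (with_proj T) v = Pair v ` (parcs T `` {v})" by (auto simp: out_arcs_def)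
  then show ?thesis unfolding out_degree_def by (simp add: card_image inj_on_def)
qed

text \<open>Groups the arcs by their tails; serves both the length sum and, with \<open>f\<close>
  constantly 1, the degree count.\<close>

lemma sum_parcs: "(\<Sum>(a, b)\<in>parcs T. f a b) = (\<Sum>a\<in>pverts T. \<Sum>b\<in>parcs T `` {a}. f a b)"
proof -
  have "Sigma (pverts T) (\<lambda>a. parcs T `` {a}) = parcs T"
    using undirected_tree_arcs_subset by auto
  moreover have "finite (parcs T `` {a})" for a
    using undirected_tree_finite(2) by (rule finite_Image)
  ultimately show ?thesis
    using sum.Sigma[OF undirected_tree_finite(1), of "\<lambda>a. parcs T `` {a}" f] by simp
qed

end

section \<open>Directions of the edges\<close>

lemma complex_of_point_simps:
  "complex_of_point (u - v) = complex_of_point u - complex_of_point v"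
  "complex_of_point (a *\<^sub>R u) = a *\<^sub>R complex_of_point u"
  by (simp_all add: complex_of_point_def complex_eq_iff)

lemma norm_complex_of_point: "norm (complex_of_point u) = norm u"
  by (simp add: complex_of_point_def norm_prod_def cmod_def)

lemma inner_complex_of_point: "complex_of_point u \<bullet> complex_of_point v = u \<bullet> v"
  by (simp add: complex_of_point_def inner_prod_def inner_complex_def)

definition arc_dir :: "real \<times> real \<Rightarrow> real \<times> real \<Rightarrow> complex" where
  "arc_dir a b = sgn (complex_of_point b - complex_of_point a)"

lemma arc_dir_commute: "arc_dir b a = - arc_dir a b"
  unfolding arc_dir_def by (metis minus_diff_eq sgn_minus)

lemma norm_arc_dir: "a \<noteq> b \<Longrightarrow> norm (arc_dir a b) = 1"
  using norm_complex_of_point[of "b - a"]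
  by (auto simp: arc_dir_def norm_sgn complex_of_point_simps)

text \<open>Multiplying an edge vector by the conjugate of its direction rotates it onto the
  nonnegative real axis.\<close>

lemma diff_mult_cnj_arc_dir:
  "(complex_of_point b - complex_of_point a) * cnj (arc_dir a b) = of_real (dist a b)"
proof -
  have *: "w * cnj (sgn w) = of_real (norm w)" for w
    by (cases "w = 0") (simp_all add: sgn_eq power2_eq_square flip: complex_norm_square)
  show ?thesis
    unfolding arc_dir_def *
    using norm_complex_of_point[of "b - a"]
    by (simp add: complex_of_point_simps dist_norm norm_minus_commute)
qed

lemma inner_arc_dir:
  assumes "vector_angle (a - s) (b - s) = 2 * pi / 3"
  shows "arc_dir s a \<bullet> arc_dir s b = - 1 / 2"
proof -
  let ?q = "((a - s) \<bullet> (b - s)) / (norm (a - s) * norm (b - s))"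
  \<comment> \<open>Cauchy-Schwarz puts \<open>?q\<close> where \<open>cos\<close> undoes
    \<open>arccos\<close>; for a zero vector, \<open>?q\<close> is 0 by the division
    convention.\<close>
  have "\<bar>?q\<bar> \<le> 1"
    using Cauchy_Schwarz_ineq2[of "a - s" "b - s"]
    by (cases "norm (a - s) * norm (b - s) = 0") (auto simp: divide_le_eq_1 abs_mult)
  then have "?q = cos (2 * pi / 3)"
    using assms cos_arccos_abs[of ?q] unfolding vector_angle_def by metis
  then have "?q = - 1 / 2" by (simp add: cos_120)
  moreover have "arc_dir s a \<bullet> arc_dir s b = ?q"
    unfolding arc_dir_def sgn_div_norm
    by (simp flip: complex_of_point_simps
        add: norm_complex_of_point inner_complex_of_point divide_inverse)
  ultimately show ?thesis by simp
qed

text \<open>Unit vectors at angle 2 pi / 3 make \<open>u ^ 2 + u * v + v ^ 2\<close> vanish, which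
  is the cofactor of \<open>u - v\<close> in \<open>u ^ 3 - v ^ 3\<close>.\<close>

lemma cube_eq_of_inner:
  fixes u v :: complex
  assumes "norm u = 1" "norm v = 1" "u \<bullet> v = - 1 / 2"
  shows "u ^ 3 = v ^ 3"
proof -
  have cn: "u * cnj u = 1" "v * cnj v = 1"
    using assms(1,2) by (simp_all flip: complex_norm_square)
  have "u * cnj v + cnj u * v = of_real (2 * (u \<bullet> v))"
    by (simp add: complex_eq_iff inner_complex_def)
  then have "u * cnj v + cnj u * v = -1" using assms(3) by simp
  then have "u * v * (u * cnj v + cnj u * v) = - (u * v)" by simp
  then have "u ^ 2 * (v * cnj v) + v ^ 2 * (u * cnj u) = - (u * v)"
    by (simp add: algebra_simps power2_eq_square)
  then have "u ^ 2 + v ^ 2 = - (u * v)" using cn by simp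
  then have "u ^ 2 + u * v + v ^ 2 = 0" by (metis add.right_inverse add.assoc add.commute)
  moreover have "u ^ 3 - v ^ 3 = (u - v) * (u ^ 2 + u * v + v ^ 2)"
    by (simp add: algebra_simps power2_eq_square power3_eq_cube)
  ultimately show ?thesis by simp
qed

text \<open>The squared norm of the sum consists of three diagonal terms 1 and six mixed terms -1/2,
  hence is 0.\<close>

lemma sum_eq_0_of_inner:
  fixes f :: "'b \<Rightarrow> 'a::real_inner"
  assumes "card B = 3" "\<And>b. b \<in> B \<Longrightarrow> norm (f b) = 1"
    "\<And>a b. a \<in> B \<Longrightarrow> b \<in> B \<Longrightarrow> a \<noteq> b \<Longrightarrow> f a \<bullet> f b = - 1 / 2"
  shows "sum f B = 0"
proof -
  obtain a b c where B: "B = {a, b, c}" and d: "a \<noteq> b" "b \<noteq> c" "a \<noteq> c"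
    using assms(1) by (auto simp: card_3_iff)
  have n: "f x \<bullet> f x = 1" if "x \<in> B" for x
    using assms(2)[OF that] by (simp add: dot_square_norm)
  have "sum f B \<bullet> sum f B = 0"
    using d n[of a] n[of b] n[of c] assms(3)[of a b] assms(3)[of b c] assms(3)[of a c]
    by (simp add: B inner_add_left inner_add_right inner_commute)
  then show ?thesis by simp
qed

lemma tree_length_eq_vertex_sum:
  assumes "undirected_tree T"
  shows "complex_of_real (tree_length T) =
    - (\<Sum>a\<in>pverts T. complex_of_point a * cnj (\<Sum>b\<in>parcs T `` {a}. arc_dir a b))"
proof -
  let ?c = complex_of_point
  let ?s = "\<Sum>(a, b)\<in>parcs T. ?c a * cnj (arc_dir a b)"
  have "prod.swap ` parcs T = parcs T"
    using undirected_tree_sym[OF assms] by (force simp: image_iff dest: symD)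
  then have "?s = (\<Sum>(a, b)\<in>parcs T. ?c b * cnj (arc_dir b a))"
    using sum.reindex[of prod.swap "parcs T" "\<lambda>(a, b). ?c a * cnj (arc_dir a b)"]
    by (simp add: case_prod_beta)
  also have "\<dots> = (\<Sum>(a, b)\<in>parcs T. - (?c b * cnj (arc_dir a b)))"
  proof (intro sum.cong refl, clarify)
    fix a b
    show "?c b * cnj (arc_dir b a) = - (?c b * cnj (arc_dir a b))"
      using arc_dir_commute[of b a] by simp
  qed
  \<comment> \<open>Adding the two expressions for \<open>?s\<close>, one per orientation, turns
    endpoints into edge vectors.\<close>
  finally have "2 * ?s = (\<Sum>(a, b)\<in>parcs T. - ((?c b - ?c a) * cnj (arc_dir a b)))"
    by (simp add: case_prod_beta sum_subtractf sum_negf algebra_simps)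
  also have "\<dots> = - of_real (\<Sum>(a, b)\<in>parcs T. dist a b)"
    by (simp add: diff_mult_cnj_arc_dir case_prod_beta sum_negf)
  finally have "2 * ?s = - of_real (\<Sum>(a, b)\<in>parcs T. dist a b)" .
  moreover have "complex_of_real (\<Sum>(a, b)\<in>parcs T. dist a b) = 2 * of_real (tree_length T)"
    by (simp add: tree_length_def)
  ultimately have "2 * of_real (tree_length T) = 2 * (- ?s)" by simp
  then have "of_real (tree_length T) = - ?s" unfolding mult_cancel_left by simp
  then show ?thesis
    unfolding sum_parcs[OF assms] by (simp add: sum_distrib_left)
qed

section \<open>Full Steiner trees\<close>

context
  fixes X :: "(real \<times> real) set" and T :: plane_graph
  assumes full: "full_steiner_tree X T" and three: "3 \<le> card X"
begin

lemma full_steiner_undirected: "undirected_tree T"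
  and full_steiner_terminals: "X \<subseteq> pverts T"
  and full_steiner_card: "card (steiner_points X T) + 2 = card X"
  using full three by (auto simp: full_steiner_tree_def steiner_tree_def)

lemma steiner_degree: "s \<in> steiner_points X T \<Longrightarrow> card (parcs T `` {s}) = 3"
  using full full_steiner_undirected
  by (simp add: full_steiner_tree_def steiner_tree_def undirected_tree_out_degree)

lemma steiner_inner:
  "s \<in> steiner_points X T \<Longrightarrow> a \<in> parcs T `` {s} \<Longrightarrow> b \<in> parcs T `` {s} \<Longrightarrow> a \<noteq> b \<Longrightarrow>
    arc_dir s a \<bullet> arc_dir s b = - 1 / 2"
  using full unfolding full_steiner_tree_def steiner_tree_def
  by (intro inner_arc_dir) (metis Image_singleton_iff)

lemma norm_arc_dir_arc: "(a, b) \<in> parcs T \<Longrightarrow> norm (arc_dir a b) = 1"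
  using undirected_tree_irrefl[OF full_steiner_undirected] unfolding irrefl_def
  by (metis norm_arc_dir)

lemma steiner_balance: "s \<in> steiner_points X T \<Longrightarrow> (\<Sum>b\<in>parcs T `` {s}. arc_dir s b) = 0"
  by (intro sum_eq_0_of_inner steiner_degree steiner_inner) (auto intro: norm_arc_dir_arc)

section \<open>Terminals are leaves next to Steiner points\<close>

text \<open>With n terminals there are 2n - 2 vertices, hence at most 4n - 6 arcs. The n - 2 Steiner
  points emit 3n - 6 of them, leaving at most n for the n terminals, each of which emits at least
  one.\<close>

lemma terminal_degree:
  assumes "p \<in> X"
  shows "card (parcs T `` {p}) = 1"
proof -
  note T = full_steiner_undirected
  note fin = undirected_tree_finite[OF T]
  let ?d = "\<lambda>v. card (parcs T `` {v})"
  have finX: "finite X" using three by (metis card.infinite not_numeral_le_zero)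
  have ge: "1 \<le> ?d q" if q: "q \<in> X" for q
  proof -
    have "\<exists>q'\<in>X. q' \<noteq> q"
    proof (rule ccontr)
      assume "\<not> ?thesis"
      then have "X \<subseteq> {q}" by auto
      then have "card X \<le> 1" using card_mono[of "{q}" X] by simp
      then show False using three by simp
    qed
    then have "parcs T `` {q} \<noteq> {}"
      using undirected_tree_neighbour[OF T] q full_steiner_terminals by blast
    then show ?thesis using fin by (simp add: Suc_le_eq card_gt_0_iff finite_Image)
  qed
  have split: "pverts T = X \<union> steiner_points X T" "X \<inter> steiner_points X T = {}"
    using full_steiner_terminals by (auto simp: steiner_points_def)
  have finS: "finite (steiner_points X T)" using fin by (simp add: steiner_points_def)
  have "card (parcs T) = (\<Sum>v\<in>pverts T. ?d v)"
    using sum_parcs[OF T, of "\<lambda>_ _. 1 :: nat"] by (simp add: case_prod_beta)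
  also have "\<dots> = (\<Sum>v\<in>X. ?d v) + (\<Sum>v\<in>steiner_points X T. ?d v)"
    unfolding split(1) using finX finS split(2) by (rule sum.union_disjoint)
  also have "\<dots> = (\<Sum>v\<in>X. ?d v) + 3 * card (steiner_points X T)"
    by (simp add: steiner_degree)
  finally have cE: "card (parcs T) = (\<Sum>v\<in>X. ?d v) + 3 * card (steiner_points X T)" .
  have cV: "card (pverts T) = card X + card (steiner_points X T)"
    unfolding split(1) using finX finS split(2) by (rule card_Un_disjoint)
  have "pverts T \<noteq> {}" using assms full_steiner_terminals by auto
  then have "(\<Sum>v\<in>X. ?d v) \<le> card X"
    using undirected_tree_card_arcs[OF T] cE cV full_steiner_card by simp
  moreover have "?d p + card (X - {p}) \<le> ?d p + (\<Sum>v\<in>X - {p}. ?d v)"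
    using ge sum_mono[of "X - {p}" "\<lambda>_. 1" ?d] by simp
  ultimately have "?d p \<le> 1"
    using sum.remove[OF finX assms, of ?d] card_Suc_Diff1[OF finX assms] by linarith
  then show ?thesis using ge[OF assms] by simp
qed

text \<open>Two adjacent terminals, being leaves, would form a whole component, which connectedness
  and a third terminal exclude.\<close>

lemma terminal_neighbour:
  assumes "p \<in> X"
  obtains s where "s \<in> steiner_points X T" "parcs T `` {p} = {s}"
proof -
  note T = full_steiner_undirected
  obtain s where s: "parcs T `` {p} = {s}"
    using terminal_degree[OF assms] by (meson card_1_singletonE)
  have sV: "s \<in> pverts T" using s undirected_tree_arcs_subset[OF T] by auto
  have "s \<notin> X"
  proof
    assume "s \<in> X"
    then obtain t where t: "parcs T `` {s} = {t}"
      using terminal_degree by (meson card_1_singletonE)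
    moreover have "p \<in> parcs T `` {s}" using s undirected_tree_sym[OF T] by (auto dest: symD)
    ultimately have sp: "parcs T `` {s} = {p}" by auto
    have "v \<in> {p, s}" if "(p, v) \<in> (parcs T)\<^sup>*" for v
      using that s sp by induction auto
    then have "X \<subseteq> {p, s}"
      using undirected_tree_connected[OF T] assms full_steiner_terminals by blast
    then have "card X \<le> card {p, s}" by (intro card_mono) auto
    also have "\<dots> \<le> 2" by (simp add: card_insert_if)
    finally show False using three by simp
  qed
  then show ?thesis using that s sV by (simp add: steiner_points_def)
qed

section \<open>Directions of terminals\<close>

text \<open>The single neighbour of a terminal is a Steiner point, so the \<open>THE\<close> in the
  definition picks it.\<close>

lemma terminal_direction_eq:
  assumes "p \<in> X" "(p, s) \<in> parcs T"
  shows "complex_of_point (terminal_direction X T p) = arc_dir s p"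
proof -
  obtain s' where "s' \<in> steiner_points X T" "parcs T `` {p} = {s'}"
    using terminal_neighbour[OF assms(1)] .
  then have "(THE S. S \<in> steiner_points X T \<and> (p, S) \<in> parcs T) = s"
    using assms(2) by (intro the_equality) (metis Image_singleton_iff singletonD)+
  then show ?thesis
    unfolding terminal_direction_def Let_def arc_dir_def sgn_div_norm
    by (simp flip: complex_of_point_simps add: norm_complex_of_point)
qed

lemma norm_terminal_direction:
  assumes "p \<in> X"
  shows "norm (complex_of_point (terminal_direction X T p)) = 1"
proof -
  obtain s where "(p, s) \<in> parcs T" using terminal_neighbour[OF assms] by blast
  then show ?thesis
    using terminal_direction_eq[OF assms] norm_arc_dir_arc arc_dir_commute[of s p] by simp
qed

lemma tree_length_eq_terminal_sum:
  "complex_of_real (tree_length T) =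
    (\<Sum>p\<in>X. complex_of_point p * cnj (complex_of_point (terminal_direction X T p)))"
proof -
  note T = full_steiner_undirected
  have "(\<Sum>a\<in>pverts T. complex_of_point a * cnj (\<Sum>b\<in>parcs T `` {a}. arc_dir a b)) =
    (\<Sum>a\<in>X. complex_of_point a * cnj (\<Sum>b\<in>parcs T `` {a}. arc_dir a b))"
    using undirected_tree_finite[OF T] full_steiner_terminals
    by (intro sum.mono_neutral_right) (auto simp: steiner_balance steiner_points_def)
  \<comment> \<open>The only arc out of a terminal points against the terminal direction; this sign
    cancels the minus of the vertex sum.\<close>
  also have "\<dots> = (\<Sum>p\<in>X. - (complex_of_point p * cnj (complex_of_point (terminal_direction X T p))))"
  proof (rule sum.cong)
    fix p assume p: "p \<in> X"
    obtain s where s: "parcs T `` {p} = {s}" using terminal_neighbour[OF p] .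
    then have "(p, s) \<in> parcs T" by auto
    then show "complex_of_point p * cnj (\<Sum>b\<in>parcs T `` {p}. arc_dir p b) =
      - (complex_of_point p * cnj (complex_of_point (terminal_direction X T p)))"
      using terminal_direction_eq[OF p] s arc_dir_commute[of s p] by simp
  qed simp
  finally show ?thesis
    unfolding tree_length_eq_vertex_sum[OF T] by (simp add: sum_negf)
qed

text \<open>At a Steiner point the cubes of the outgoing directions agree; reversing an arc only changes
  the sign of the cube. So the sixth power is constant along every walk.\<close>

lemma arc_dir_power6_vertex:
  assumes "(a, b) \<in> parcs T" "(a, c) \<in> parcs T"
  shows "arc_dir a b ^ 6 = arc_dir a c ^ 6"
proof (cases "b = c")
  case False
  \<comment> \<open>Two different arcs leave \<open>a\<close>, whereas terminals are leaves.\<close>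
  have "a \<notin> X"
  proof
    assume "a \<in> X"
    then obtain s where "parcs T `` {a} = {s}" using terminal_neighbour by metis
    then show False using assms False by (metis Image_singleton_iff singletonD)
  qed
  then have "a \<in> steiner_points X T"
    using assms undirected_tree_arcs_subset[OF full_steiner_undirected]
    by (auto simp: steiner_points_def)
  then have "arc_dir a b ^ 3 = arc_dir a c ^ 3"
    using assms False by (intro cube_eq_of_inner norm_arc_dir_arc steiner_inner) auto
  then have "(arc_dir a b ^ 3) ^ 2 = (arc_dir a c ^ 3) ^ 2" by simp
  then show ?thesis unfolding power_mult[symmetric] by simp
qed simp

lemma arc_dir_power6:
  assumes "(a, b) \<in> parcs T" "(c, d) \<in> parcs T"
  shows "arc_dir a b ^ 6 = arc_dir c d ^ 6"
proof -
  note T = full_steiner_undirected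
  have "(a, c) \<in> (parcs T)\<^sup>*"
    using assms undirected_tree_arcs_subset[OF T] by (intro undirected_tree_connected[OF T]) auto
  \<comment> \<open>The claim covers every arc leaving the current endpoint, so the step can use the
    reversed arc \<open>(v, u)\<close> and then switch to any other arc at \<open>v\<close>.\<close>
  then have "\<forall>d. (c, d) \<in> parcs T \<longrightarrow> arc_dir a b ^ 6 = arc_dir c d ^ 6"
  proof induction
    case base
    then show ?case using assms(1) arc_dir_power6_vertex by blast
  next
    case (step u v)
    have "(v, u) \<in> parcs T" using step.hyps(2) undirected_tree_sym[OF T] by (auto dest: symD)
    moreover have "arc_dir v u ^ 6 = arc_dir u v ^ 6" using arc_dir_commute[of v u] by simp
    ultimately show ?case using step arc_dir_power6_vertex by metis
  qed
  then show ?thesis using assms(2) by blast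
qed

lemma terminal_direction_power6:
  assumes "p \<in> X" "q \<in> X"
  shows "complex_of_point (terminal_direction X T p) ^ 6 =
    complex_of_point (terminal_direction X T q) ^ 6"
proof -
  obtain s t where "(p, s) \<in> parcs T" "(q, t) \<in> parcs T"
    using terminal_neighbour assms by (metis Image_singleton_iff singletonI)
  then show ?thesis
    using terminal_direction_eq[OF assms(1)] terminal_direction_eq[OF assms(2)]
      arc_dir_power6[of s p t q] undirected_tree_sym[OF full_steiner_undirected]
    by (metis symD)
qed

end

section \<open>Sixth roots of unity and the length formula\<close>

lemma sixth_root_eq_cis: "sixth_root k = cis (real k * pi / 3)"
  by (simp add: sixth_root_def complex_eq_iff mult.commute)

text \<open>Provides the index \<open>k\<close> for the assumption on \<open>U\<close>: for
  \<open>k < 6\<close> the angle lies in [0, 2 pi), the range of \<open>Arg2pi\<close>.\<close>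

lemma sixth_root_cases:
  fixes r :: complex
  assumes "r ^ 6 = 1"
  obtains k where "k \<in> {0..5}" "Arg2pi r = real k * pi / 3" "r = sixth_root k"
proof -
  have "r \<in> (\<lambda>k. cis (2 * pi * real k / real 6)) ` {..<6}"
    unfolding bij_betw_imp_surj_on[OF Complex.bij_betw_roots_unity[of 6, OF zero_less_numeral]]
    using assms by simp
  then obtain k :: nat where k: "k < 6" "r = cis (2 * pi * real k / real 6)" by blast
  then have r: "r = cis (real k * pi / 3)" by (simp add: field_simps)
  have "real k * pi / 3 < 2 * pi" using k(1) by simp
  then have "Arg2pi r = real k * pi / 3"
    using r by (intro Arg2pi_unique[of 1]) (auto simp: cis_conv_exp)
  then show ?thesis using that k(1) r by (simp add: sixth_root_eq_cis)
qed

theorem theorem3p1: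
  fixes n :: nat
    and T :: plane_graph
    and P :: "nat \<Rightarrow> real \<times> real"
    and x y :: "nat \<Rightarrow> real"
    and z U :: "nat \<Rightarrow> complex"
    and l :: "nat \<Rightarrow> real \<times> real"
  assumes "n \<ge> 3"
    and "inj_on P {1..n}"
    and "full_steiner_tree (P ` {1..n}) T"
    and "\<And>j. j \<in> {1..n} \<Longrightarrow> P j = (x j, y j)"
    and "\<And>j. j \<in> {1..n} \<Longrightarrow> z j = complex_of_real (x j) + \<i> * complex_of_real (y j)"
    and "\<And>j. j \<in> {1..n} \<Longrightarrow> l j = terminal_direction (P ` {1..n}) T (P j)"
    and "U 1 = sixth_root 0"
    and "\<And>j k. j \<in> {1..n} \<Longrightarrow> k \<in> {0..5} \<Longrightarrow>
           clockwise_angle (l 1) (l j) = real k * pi / 3 \<Longrightarrow> U j = sixth_root k"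
  shows "tree_length T = cmod (\<Sum>j = 1..n. z j * U j)"
proof -
  let ?X = "P ` {1..n}"
  define u where "u j = complex_of_point (l j)" for j
  have cX: "3 \<le> card ?X" using assms(1,2) by (simp add: card_image)
  have one: "1 \<in> {1..n}" using assms(1) by simp
  have norm_u: "norm (u j) = 1" if "j \<in> {1..n}" for j
    using norm_terminal_direction[OF assms(3) cX] that assms(6) by (simp add: u_def)
  have z: "z j = complex_of_point (P j)" if "j \<in> {1..n}" for j
    using that assms(4,5) by (simp add: complex_of_point_def complex_eq_iff)
  \<comment> \<open>The clockwise angle is the argument of \<open>u 1 / u j\<close>, a sixth root of
    unity because the sixth powers agree. So \<open>U j\<close> is this ratio, and dividing by the
    unit \<open>u j\<close> means multiplying by its conjugate.\<close>
  have U: "U j = u 1 * cnj (u j)" if j: "j \<in> {1..n}" for j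
  proof -
    have ne: "u j \<noteq> 0" using norm_u[OF j] by auto
    have "u 1 ^ 6 = u j ^ 6"
      unfolding u_def assms(6)[OF one] assms(6)[OF j]
      using one j by (intro terminal_direction_power6[OF assms(3) cX]) auto
    then have "(u 1 / u j) ^ 6 = 1" using ne by (simp add: power_divide)
    then obtain k where "k \<in> {0..5}" "Arg2pi (u 1 / u j) = real k * pi / 3"
      "u 1 / u j = sixth_root k"
      by (rule sixth_root_cases)
    then have "U j = u 1 / u j"
      using assms(8)[OF j] by (simp add: clockwise_angle_def u_def)
    also have "\<dots> = u 1 * cnj (u j)"
      using norm_u[OF j] ne complex_norm_square[of "u j"]
      by (simp add: divide_eq_eq mult.assoc mult.commute[of "cnj _"])
    finally show ?thesis .
  qed
  have "of_real (tree_length T) = (\<Sum>j = 1..n. z j * cnj (u j))"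
    unfolding tree_length_eq_terminal_sum[OF assms(3) cX] sum.reindex[OF assms(2)]
    by (intro sum.cong) (simp_all add: z u_def assms(6))
  moreover have "(\<Sum>j = 1..n. z j * U j) = u 1 * (\<Sum>j = 1..n. z j * cnj (u j))"
    by (simp add: U sum_distrib_left mult.left_commute)
  \<comment> \<open>The common factor \<open>u 1\<close> has norm 1, so only the absolute value of
    the length remains.\<close>
  ultimately have "cmod (\<Sum>j = 1..n. z j * U j) = \<bar>tree_length T\<bar>"
    by (metis mult_1 norm_mult norm_of_real norm_u[OF one])
  moreover have "0 \<le> tree_length T"
    by (auto simp: tree_length_def intro!: sum_nonneg)
  ultimately show ?thesis by simp
qed

end
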